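(* Let $K$ be a field of characteristic different from $2$, let $n\ge 1$, and let $R=K[a_{i,j}\mid 1\le i<j\le 2n]$ be the polynomial ring in the ${2n\choose 2}$ indeterminates $a_{i,j}$, $i<j$. Put $a_{j,i}:=a_{i,j}$ for $i<j$ (symmetric generators), and let $S_{2n}$ act on $R$ by $K$-algebra automorphisms determined on generators by $\sigma\, a_{i,j}=a_{\sigma^{-1}(i),\sigma^{-1}(j)}$. Let $$pf_{2n}=\sum_{\pi\in S_{2n,pf}}\operatorname{sign}(\pi)\, a_{i_1,j_1}a_{i_2,j_2}\cdots a_{i_n,j_n}\in R$$ be the Pfaffian polynomial (notation in the context). Then the symmetry group $$\operatorname{Sym}(pf_{2n})=\{\sigma\in S_{2n}\mid \sigma\, pf_{2n}=pf_{2n}\}$$ is isomorphic to (indeed equal to) the dihedral group $D_{2n}\subseteq S_{2n}$.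
   Context: $S_{2n,pf}$ is the set of "Pfaff permutations": permutations $\pi\in S_{2n}$ whose one-line notation is $\pi=(i_1,j_1,i_2,j_2,\ldots,i_n,j_n)$ (i.e. $\pi(2s-1)=i_s$, $\pi(2s)=j_s$) with $i_1<i_2<\cdots<i_n$ and $i_s<j_s$ for all $1\le s\le n$; $\operatorname{sign}(\pi)$ is the usual sign of the permutation. $D_{2n}$ denotes the dihedral group realized as the group of permutations of $\{1,\ldots,2n\}$ induced by the symmetries of a regular $2n$-gon whose vertices are labelled $1,2,\ldots,2n$ in cyclic order; equivalently the subgroup of $S_{2n}$ generated by the cyclic shift $i\mapsto i+1 \pmod{2n}$ and the reflection fixing $1$ and sending $i\mapsto 2n+2-i$ for $2\le i\le 2n$. *)

theory Defs
  imports "HOL-Library.Poly_Mapping" "HOL-Algebra.Sym_Groups"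
begin

text \<open>
  Polynomials over \<open>'k\<close> in indeterminates indexed by \<open>nat \<times> nat\<close> are finitely supported maps
  from monomials to coefficients, monomials being finitely supported exponent functions. The ring
  \<open>R = K[a_{i,j} | 1 \<le> i < j \<le> 2n]\<close> is the subring \<open>pf_ring n\<close> below.
\<close>

type_synonym 'k pol = "((nat \<times> nat) \<Rightarrow>\<^sub>0 nat) \<Rightarrow>\<^sub>0 'k"

definition const :: "'k::field \<Rightarrow> 'k pol" where
  "const c = Poly_Mapping.single 0 c"

definition var :: "nat \<times> nat \<Rightarrow> 'k::field pol" where
  "var v = Poly_Mapping.single (Poly_Mapping.single v 1) 1"

definition pf_ring :: "nat \<Rightarrow> 'k::field pol set" where
  "pf_ring n = {p. \<forall>m \<in> Poly_Mapping.keys p.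
     Poly_Mapping.keys m \<subseteq> {(i, j). 1 \<le> i \<and> i < j \<and> j \<le> 2 * n}}"

text \<open>Symmetric generators: \<open>gen j i = gen i j\<close>.\<close>

definition gen :: "nat \<Rightarrow> nat \<Rightarrow> 'k::field pol" where
  "gen i j = var (min i j, max i j)"

text \<open>The \<open>K\<close>-algebra endomorphism sending the indeterminate \<open>v\<close> to \<open>f v\<close>.\<close>

definition subst :: "(nat \<times> nat \<Rightarrow> 'k::field pol) \<Rightarrow> 'k pol \<Rightarrow> 'k pol" where
  "subst f p = (\<Sum>m \<in> Poly_Mapping.keys p. const (Poly_Mapping.lookup p m) *
     (\<Prod>v \<in> Poly_Mapping.keys m. f v ^ Poly_Mapping.lookup m v))"

text \<open>
  On \<open>pf_ring n\<close>, a permutation of \<open>{1..2n}\<close> acts by an automorphism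
  (\<open>act_bij_betw\<close> and the homomorphism lemmas below).
\<close>

definition act :: "(nat \<Rightarrow> nat) \<Rightarrow> 'k::field pol \<Rightarrow> 'k pol" where
  "act \<sigma> = subst (\<lambda>(i, j). gen (inv_into UNIV \<sigma> i) (inv_into UNIV \<sigma> j))"

definition pfaff_perms :: "nat \<Rightarrow> (nat \<Rightarrow> nat) set" where
  "pfaff_perms n = {\<pi>. \<pi> permutes {1..2 * n} \<and>
     strict_mono_on {1..n} (\<lambda>s. \<pi> (2 * s - 1)) \<and>
     (\<forall>s \<in> {1..n}. \<pi> (2 * s - 1) < \<pi> (2 * s))}"

definition pf :: "nat \<Rightarrow> 'k::field pol" where
  "pf n = (\<Sum>\<pi> \<in> pfaff_perms n. of_int (sign \<pi>) *
     (\<Prod>s = 1..n. gen (\<pi> (2 * s - 1)) (\<pi> (2 * s))))"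

definition Sym :: "nat \<Rightarrow> 'k::field pol \<Rightarrow> (nat \<Rightarrow> nat) set" where
  "Sym n p = {\<sigma> \<in> carrier (sym_group (2 * n)). act \<sigma> p = p}"

definition cyc_shift :: "nat \<Rightarrow> nat \<Rightarrow> nat" where
  "cyc_shift m i = (if 1 \<le> i \<and> i < m then i + 1 else if i = m then 1 else i)"

definition reflection :: "nat \<Rightarrow> nat \<Rightarrow> nat" where
  "reflection m i = (if 2 \<le> i \<and> i \<le> m then m + 2 - i else i)"

text \<open>
  The symmetries of a regular \<open>m\<close>-gon with vertices \<open>1, \<dots>, m\<close> in cyclic order. For \<open>m = 2\<close> the
  reflection is the identity and the group has order \<open>2\<close>.
\<close>

definition dihedral :: "nat \<Rightarrow> (nat \<Rightarrow> nat) set" where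
  "dihedral m = generate (sym_group m) {cyc_shift m, reflection m}"

lemma cyc_shift_permutes:
  assumes "1 \<le> m"
  shows "cyc_shift m permutes {1..m}"
proof (rule bij_imp_permutes)
  have "inj_on (cyc_shift m) {1..m}"
    by (auto simp: inj_on_def cyc_shift_def split: if_splits)
  moreover have "cyc_shift m ` {1..m} \<subseteq> {1..m}"
    using assms by (auto simp: cyc_shift_def)
  ultimately show "bij_betw (cyc_shift m) {1..m} {1..m}"
    by (simp add: bij_betw_def endo_inj_surj)
qed (use assms in \<open>auto simp: cyc_shift_def\<close>)

lemma reflection_permutes: "reflection m permutes {1..m}"
proof (rule bij_imp_permutes)
  have "inj_on (reflection m) {1..m}"
    by (auto simp: inj_on_def reflection_def split: if_splits)
  moreover have "reflection m ` {1..m} \<subseteq> {1..m}"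
    by (auto simp: reflection_def)
  ultimately show "bij_betw (reflection m) {1..m} {1..m}"
    by (simp add: bij_betw_def endo_inj_surj)
qed (auto simp: reflection_def)

subsection \<open>Substitution is a \<open>K\<close>-algebra homomorphism\<close>

lemma const_0 [simp]: "const 0 = 0" and const_1 [simp]: "const 1 = 1"
  by (simp_all add: const_def)

lemma const_add: "const (a + b) = const a + const b"
  by (simp add: const_def single_add)

lemma const_mult: "const (a * b) = const a * const b"
  by (simp add: const_def mult_single)

lemma subst_superset:
  assumes "finite A" "Poly_Mapping.keys p \<subseteq> A"
  shows "subst f p = (\<Sum>m \<in> A. const (Poly_Mapping.lookup p m) *
     (\<Prod>v \<in> Poly_Mapping.keys m. f v ^ Poly_Mapping.lookup m v))"
  unfolding subst_def
  by (rule sum.mono_neutral_left) (use assms in \<open>auto simp: in_keys_iff\<close>)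

lemma subst_0 [simp]: "subst f 0 = 0"
  by (simp add: subst_def)

lemma subst_add: "subst f (p + q) = subst f p + subst f q"
proof -
  let ?A = "Poly_Mapping.keys p \<union> Poly_Mapping.keys q"
  have "Poly_Mapping.keys (p + q) \<subseteq> ?A"
    by (rule Poly_Mapping.keys_add)
  then show ?thesis
    by (simp add: subst_superset[of ?A] lookup_add const_add distrib_right sum.distrib)
qed

lemma subst_sum: "subst f (\<Sum>x \<in> A. g x) = (\<Sum>x \<in> A. subst f (g x))"
  by (induction A rule: infinite_finite_induct) (simp_all add: subst_add)

lemma subst_single:
  "subst f (Poly_Mapping.single m c) =
     const c * (\<Prod>v \<in> Poly_Mapping.keys m. f v ^ Poly_Mapping.lookup m v)"
  by (simp add: subst_superset[of "{m}"])

lemma subst_const: "subst f (const c) = const c"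
  using subst_single[of f 0 c] by (simp add: const_def)

lemma subst_1 [simp]: "subst f 1 = 1"
  using subst_const[of f 1] by simp

lemma subst_var: "subst f (var v) = f v"
  by (simp add: var_def subst_single)

lemma sum_singles:
  fixes p :: "'a \<Rightarrow>\<^sub>0 'b::comm_monoid_add"
  shows "p = (\<Sum>m \<in> Poly_Mapping.keys p. Poly_Mapping.single m (Poly_Mapping.lookup p m))"
  by (rule poly_mapping_eqI)
     (simp add: lookup_sum lookup_single when_def in_keys_iff)

lemma prod_pow_add:
  fixes f :: "'a \<Rightarrow> 'b::comm_semiring_1"
  shows "(\<Prod>v \<in> Poly_Mapping.keys (m + m'). f v ^ Poly_Mapping.lookup (m + m') v) =
    (\<Prod>v \<in> Poly_Mapping.keys m. f v ^ Poly_Mapping.lookup m v) *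
    (\<Prod>v \<in> Poly_Mapping.keys m'. f v ^ Poly_Mapping.lookup m' v)"
proof -
  let ?A = "Poly_Mapping.keys m \<union> Poly_Mapping.keys m'"
  have *: "(\<Prod>v \<in> Poly_Mapping.keys k. f v ^ Poly_Mapping.lookup k v) =
      (\<Prod>v \<in> ?A. f v ^ Poly_Mapping.lookup k v)"
    if "Poly_Mapping.keys k \<subseteq> ?A" for k :: "'a \<Rightarrow>\<^sub>0 nat"
    by (rule prod.mono_neutral_left) (use that in \<open>auto simp: in_keys_iff\<close>)
  have "Poly_Mapping.keys (m + m') \<subseteq> ?A"
    by (rule Poly_Mapping.keys_add)
  from *[OF this] *[of m] *[of m'] show ?thesis
    by (simp only: Un_upper1 Un_upper2 lookup_add power_add prod.distrib)
qed

lemma subst_mult: "subst f (p * q) = subst f p * subst f q"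
proof -
  have single: "subst f (Poly_Mapping.single m c * Poly_Mapping.single m' c') =
      subst f (Poly_Mapping.single m c) * subst f (Poly_Mapping.single m' c')" for m c m' c'
    by (simp add: mult_single subst_single const_mult prod_pow_add mult_ac)
  show ?thesis
    by (subst (1 2) sum_singles[of p], subst (1 2) sum_singles[of q])
       (simp only: sum_product subst_sum single)
qed

lemma subst_power: "subst f (p ^ k) = subst f p ^ k"
  by (induction k) (simp_all add: subst_mult)

lemma subst_prod: "subst f (\<Prod>x \<in> A. g x) = (\<Prod>x \<in> A. subst f (g x))"
  by (induction A rule: infinite_finite_induct) (simp_all add: subst_mult)

lemma subst_subst: "subst f (subst g p) = subst (\<lambda>v. subst f (g v)) p"
  by (simp add: subst_def[of g] subst_def[of "\<lambda>v. subst f (g v)"]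
        subst_sum subst_mult subst_const subst_prod subst_power)

lemma subst_var_id: "subst var p = (p :: 'k::field pol)"
proof -
  have pow: "var v ^ k = (Poly_Mapping.single (Poly_Mapping.single v k) 1 :: 'k pol)" for v k
    by (induction k) (simp_all add: var_def mult_single single_add[symmetric])
  have prod: "(\<Prod>v \<in> A. Poly_Mapping.single (g v) 1 :: 'k pol) =
      Poly_Mapping.single (\<Sum>v \<in> A. g v) 1" for A :: "(nat \<times> nat) set" and g
    by (induction A rule: infinite_finite_induct) (simp_all add: mult_single)
  have "subst var p =
      (\<Sum>m \<in> Poly_Mapping.keys p. Poly_Mapping.single m (Poly_Mapping.lookup p m))"
    by (simp add: subst_def pow prod const_def mult_single flip: sum_singles)
  also have "\<dots> = p"
    by (rule sum_singles[symmetric])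
  finally show ?thesis .
qed

lemma subst_cong:
  assumes "\<And>m v. m \<in> Poly_Mapping.keys p \<Longrightarrow> v \<in> Poly_Mapping.keys m \<Longrightarrow> f v = g v"
  shows "subst f p = subst g p"
  unfolding subst_def by (intro sum.cong prod.cong arg_cong2[of _ _ _ _ "(*)"]) (simp_all add: assms)

subsection \<open>The action on \<open>pf_ring\<close>\<close>

lemma const_in_pf_ring: "const c \<in> pf_ring n"
  by (auto simp: pf_ring_def const_def split: if_splits)

lemma zero_in_pf_ring [simp]: "0 \<in> pf_ring n" and one_in_pf_ring [simp]: "1 \<in> pf_ring n"
  using const_in_pf_ring[of 0] const_in_pf_ring[of 1] by simp_all

lemma gen_in_pf_ring:
  assumes "i \<in> {1..2 * n}" "j \<in> {1..2 * n}" "i \<noteq> j"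
  shows "gen i j \<in> pf_ring n"
  using assms by (auto simp: pf_ring_def gen_def var_def)

lemma add_in_pf_ring: "p \<in> pf_ring n \<Longrightarrow> q \<in> pf_ring n \<Longrightarrow> p + q \<in> pf_ring n"
  unfolding pf_ring_def using Poly_Mapping.keys_add[of p q] by blast

lemma mult_in_pf_ring:
  assumes "p \<in> pf_ring n" "q \<in> pf_ring n"
  shows "p * q \<in> pf_ring n"
  unfolding pf_ring_def mem_Collect_eq
proof
  fix m assume "m \<in> Poly_Mapping.keys (p * q)"
  with keys_mult[of p q] obtain a b
    where "m = a + b" "a \<in> Poly_Mapping.keys p" "b \<in> Poly_Mapping.keys q" by blast
  with assms Poly_Mapping.keys_add[of a b]
  show "Poly_Mapping.keys m \<subseteq> {(i, j). 1 \<le> i \<and> i < j \<and> j \<le> 2 * n}"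
    unfolding pf_ring_def by blast
qed

lemma sum_in_pf_ring: "(\<And>x. x \<in> A \<Longrightarrow> g x \<in> pf_ring n) \<Longrightarrow> (\<Sum>x \<in> A. g x) \<in> pf_ring n"
  by (induction A rule: infinite_finite_induct) (simp_all add: add_in_pf_ring)

lemma prod_in_pf_ring: "(\<And>x. x \<in> A \<Longrightarrow> g x \<in> pf_ring n) \<Longrightarrow> (\<Prod>x \<in> A. g x) \<in> pf_ring n"
  by (induction A rule: infinite_finite_induct) (simp_all add: mult_in_pf_ring)

lemma power_in_pf_ring: "p \<in> pf_ring n \<Longrightarrow> p ^ k \<in> pf_ring n"
  by (induction k) (simp_all add: mult_in_pf_ring)

lemma of_int_const: "of_int k = const (of_int k)"
  by (simp add: const_def single_of_int)

lemma pf_in_pf_ring: "pf n \<in> pf_ring n"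
proof -
  have "gen (\<pi> (2 * s - 1)) (\<pi> (2 * s)) \<in> pf_ring n"
    if "\<pi> \<in> pfaff_perms n" "s \<in> {1..n}" for \<pi> s
  proof (rule gen_in_pf_ring)
    have "\<pi> permutes {1..2 * n}" using that by (simp add: pfaff_perms_def)
    moreover have "2 * s - 1 \<in> {1..2 * n}" "2 * s \<in> {1..2 * n}" using that by auto
    ultimately show "\<pi> (2 * s - 1) \<in> {1..2 * n}" "\<pi> (2 * s) \<in> {1..2 * n}"
      by (simp_all only: permutes_in_image)
    show "\<pi> (2 * s - 1) \<noteq> \<pi> (2 * s)"
      using that unfolding pfaff_perms_def by (metis (lifting) less_irrefl mem_Collect_eq)
  qed
  then show ?thesis
    unfolding pf_def of_int_const
    by (intro sum_in_pf_ring mult_in_pf_ring const_in_pf_ring prod_in_pf_ring)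
qed

lemma act_add: "act \<sigma> (p + q) = act \<sigma> p + act \<sigma> q"
  by (simp add: act_def subst_add)

lemma act_mult: "act \<sigma> (p * q) = act \<sigma> p * act \<sigma> q"
  by (simp add: act_def subst_mult)

lemma act_const: "act \<sigma> (const c) = const c"
  by (simp add: act_def subst_const)

lemma act_gen: "act \<sigma> (gen i j) = gen (inv_into UNIV \<sigma> i) (inv_into UNIV \<sigma> j)"
  by (cases "i \<le> j")
     (simp_all add: act_def gen_def subst_var min.commute max.commute min_def max_def)

lemma act_in_pf_ring:
  assumes "\<sigma> permutes {1..2 * n}" "p \<in> pf_ring n"
  shows "act \<sigma> p \<in> pf_ring n"
proof -
  have gen: "gen (inv_into UNIV \<sigma> i) (inv_into UNIV \<sigma> j) \<in> pf_ring n"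
    if "1 \<le> i" "i < j" "j \<le> 2 * n" for i j
  proof (rule gen_in_pf_ring)
    have "inv_into UNIV \<sigma> permutes {1..2 * n}" by (rule permutes_inv[OF assms(1)])
    moreover have "i \<in> {1..2 * n}" "j \<in> {1..2 * n}" using that by auto
    ultimately show "inv_into UNIV \<sigma> i \<in> {1..2 * n}" "inv_into UNIV \<sigma> j \<in> {1..2 * n}"
      by (simp_all only: permutes_in_image)
    show "inv_into UNIV \<sigma> i \<noteq> inv_into UNIV \<sigma> j"
      using that permutes_inv_eq[OF assms(1)] by (metis less_irrefl)
  qed
  show ?thesis
    unfolding act_def subst_def
  proof (intro sum_in_pf_ring mult_in_pf_ring const_in_pf_ring prod_in_pf_ring power_in_pf_ring)
    fix m v assume "m \<in> Poly_Mapping.keys p" "v \<in> Poly_Mapping.keys m"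
    then have "v \<in> {(i, j). 1 \<le> i \<and> i < j \<and> j \<le> 2 * n}"
      using assms(2) unfolding pf_ring_def by blast
    then show "(case v of (i, j) \<Rightarrow> gen (inv_into UNIV \<sigma> i) (inv_into UNIV \<sigma> j)) \<in> pf_ring n"
      using gen by auto
  qed
qed

lemma act_inverse:
  assumes "\<sigma> permutes {1..2 * n}" "\<tau> permutes {1..2 * n}" "\<tau> \<circ> \<sigma> = id" "p \<in> pf_ring n"
  shows "act \<sigma> (act \<tau> p) = p"
proof -
  let ?f = "\<lambda>(i, j). gen (inv_into UNIV \<tau> i) (inv_into UNIV \<tau> j)"
  have inv: "inv_into UNIV \<sigma> (inv_into UNIV \<tau> i) = i" for i
    using assms(1-3) by (metis comp_apply id_apply permutes_inv_eq)
  have "act \<sigma> (act \<tau> p) = subst (\<lambda>v. act \<sigma> (?f v)) p"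
    by (simp add: act_def subst_subst)
  also have "\<dots> = subst var p"
  proof (rule subst_cong)
    fix m v assume "m \<in> Poly_Mapping.keys p" "v \<in> Poly_Mapping.keys m"
    then have "v \<in> {(i, j). 1 \<le> i \<and> i < j \<and> j \<le> 2 * n}"
      using assms(4) unfolding pf_ring_def by blast
    then show "act \<sigma> (?f v) = var v"
      by (auto simp: act_gen inv) (auto simp: gen_def)
  qed
  also have "\<dots> = p" by (rule subst_var_id)
  finally show ?thesis .
qed

lemma act_bij_betw:
  assumes "\<sigma> permutes {1..2 * n}"
  shows "bij_betw (act \<sigma>) (pf_ring n) (pf_ring n)"
proof (rule bij_betw_byWitness[where f' = "act (inv_into UNIV \<sigma>)"])
  note inv = permutes_inv[OF assms]
  show "\<forall>p \<in> pf_ring n. act (inv_into UNIV \<sigma>) (act \<sigma> p) = p"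
    using act_inverse[OF inv assms permutes_inv_o(1)[OF assms]] by blast
  show "\<forall>p \<in> pf_ring n. act \<sigma> (act (inv_into UNIV \<sigma>) p) = p"
    using act_inverse[OF assms inv permutes_inv_o(2)[OF assms]] by blast
qed (use act_in_pf_ring assms permutes_inv in blast)+

end

theory Submission
  imports Defs
begin

text \<open>
  Let \<open>E(\<pi>)\<close> be the sign of a permutation \<open>\<pi>\<close> times the signs of \<open>\<pi>(2s) - \<pi>(2s - 1)\<close>. It depends only on
  the perfect matching \<open>{{\<pi>(2s - 1), \<pi>(2s)}}\<close> and is the coefficient of that matching in the Pfaffian,
  so in characteristic other than 2 a permutation \<open>\<sigma>\<close> fixes the Pfaffian iff \<open>E(\<sigma>\<pi>) = E(\<pi>)\<close> for all
  \<open>\<pi>\<close>. Equivalently, the number of edges of a matching that \<open>\<sigma>\<close> inverts has the parity of \<open>\<sigma>\<close>, for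
  every matching. The shift inverts the one edge at \<open>2n\<close>; the reflection inverts every edge except the
  one at \<open>1\<close>. Conversely, using shifts one may assume \<open>\<sigma>(1) = 1\<close>. Edges at \<open>1\<close> are then never
  inverted, so comparing two matchings that differ on the vertices \<open>1, j, j + 1, j + 2\<close> shows that \<open>\<sigma>\<close>
  is monotone on \<open>{2..2n}\<close>, hence the identity or the reflection.
\<close>

section \<open>Invariants of the perfect matching encoded by a permutation\<close>

text \<open>The quantity \<open>E\<close> above. The \<open>sgn\<close> factor of a block
  compensates for the change of \<open>sign\<close> when the two entries of that block are
  exchanged.\<close>

definition matching_sign :: "nat \<Rightarrow> (nat \<Rightarrow> nat) \<Rightarrow> int" where
  "matching_sign n \<pi> = sign \<pi> * (\<Prod>s = 1..n. sgn (int (\<pi> (2 * s)) - int (\<pi> (2 * s - 1))))"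

text \<open>The exponent of the product of the \<open>gen\<close> factors of the blocks;
  \<open>min\<close> and \<open>max\<close> mirror the symmetric generators.\<close>

definition matching_monom :: "nat \<Rightarrow> (nat \<Rightarrow> nat) \<Rightarrow> (nat \<times> nat) \<Rightarrow>\<^sub>0 nat" where
  "matching_monom n \<pi> = (\<Sum>s = 1..n. Poly_Mapping.single
     (min (\<pi> (2 * s - 1)) (\<pi> (2 * s)), max (\<pi> (2 * s - 1)) (\<pi> (2 * s))) 1)"

definition matching_edges :: "nat \<Rightarrow> (nat \<Rightarrow> nat) \<Rightarrow> nat set set" where
  "matching_edges n \<pi> = (\<lambda>s. {\<pi> (2 * s - 1), \<pi> (2 * s)}) ` {1..n}"

text \<open>Defined through the wanted invariance instead of as a wreath product: closure under
  composition is then immediate, and only flips of one block and swaps of neighbouring blocks have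
  to be checked.\<close>

definition block_perms :: "nat \<Rightarrow> (nat \<Rightarrow> nat) set" where
  "block_perms n = {\<rho>. \<rho> permutes {1..2 * n} \<and> (\<forall>\<pi>. \<pi> permutes {1..2 * n} \<longrightarrow>
     matching_sign n (\<pi> \<circ> \<rho>) = matching_sign n \<pi> \<and>
     matching_monom n (\<pi> \<circ> \<rho>) = matching_monom n \<pi>)}"

lemma sign_compose_permutes:
  assumes "finite A" "p permutes A" "q permutes A"
  shows "sign (p \<circ> q) = sign p * sign q"
  using assms by (metis permutation_permutes sign_compose)

lemma prod_negate_one:
  fixes f g :: "'a \<Rightarrow> 'b::comm_ring_1"
  assumes "finite A" "s \<in> A" "\<And>t. t \<in> A \<Longrightarrow> f t = (if t = s then - g t else g t)"
  shows "prod f A = - prod g A"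
proof -
  have "prod f A = (\<Prod>t \<in> A. (if t = s then - 1 else 1) * g t)"
    by (rule prod.cong) (auto simp: assms(3))
  also have "\<dots> = - prod g A"
    using assms(1,2) by (simp add: prod.distrib prod.delta)
  finally show ?thesis .
qed

subsection \<open>Normal forms of matchings\<close>

lemma block_perms_id: "id \<in> block_perms n"
  by (simp add: block_perms_def permutes_id)

lemma block_perms_comp:
  assumes "\<rho> \<in> block_perms n" "\<rho>' \<in> block_perms n"
  shows "\<rho> \<circ> \<rho>' \<in> block_perms n"
  using assms unfolding block_perms_def
  by (simp add: permutes_compose flip: comp_assoc)

lemma block_flip_apply:
  fixes s t :: nat
  assumes "1 \<le> s" "1 \<le> t"
  shows "transpose (2 * s - 1) (2 * s) (2 * t - 1) = (if t = s then 2 * t else 2 * t - 1)"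
    and "transpose (2 * s - 1) (2 * s) (2 * t) = (if t = s then 2 * t - 1 else 2 * t)"
proof -
  \<comment> \<open>Successors turn the truncated difference \<open>2 * s - 1\<close> into a
    sum.\<close>
  obtain a b where "s = Suc a" "t = Suc b"
    using assms by (metis Suc_le_D One_nat_def)
  then show "transpose (2 * s - 1) (2 * s) (2 * t - 1) = (if t = s then 2 * t else 2 * t - 1)"
    and "transpose (2 * s - 1) (2 * s) (2 * t) = (if t = s then 2 * t - 1 else 2 * t)"
    by (simp_all add: transpose_def)
qed

text \<open>The transposition negates \<open>sign\<close> and exactly one \<open>sgn\<close> factor,
  so the two changes cancel.\<close>

lemma block_flip:
  assumes "s \<in> {1..n}"
  shows "transpose (2 * s - 1) (2 * s) \<in> block_perms n" (is "?\<rho> \<in> _")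
proof -
  have perm: "?\<rho> permutes {1..2 * n}"
    using assms by (intro permutes_swap_id) auto
  have val: "?\<rho> (2 * t - 1) = (if t = s then 2 * t else 2 * t - 1)"
    "?\<rho> (2 * t) = (if t = s then 2 * t - 1 else 2 * t)" if "t \<in> {1..n}" for t
    using that assms block_flip_apply[of s t] by simp_all
  have neq: "2 * s - 1 \<noteq> 2 * s" using assms by auto
  have "matching_sign n (\<pi> \<circ> ?\<rho>) = matching_sign n \<pi>" if "\<pi> permutes {1..2 * n}" for \<pi>
  proof -
    have "(\<Prod>t = 1..n. sgn (int ((\<pi> \<circ> ?\<rho>) (2 * t)) - int ((\<pi> \<circ> ?\<rho>) (2 * t - 1)))) =
      - (\<Prod>t = 1..n. sgn (int (\<pi> (2 * t)) - int (\<pi> (2 * t - 1))))"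
      by (rule prod_negate_one[of _ s]) (use assms in \<open>simp_all add: val flip: sgn_minus\<close>)
    moreover have "sign (\<pi> \<circ> ?\<rho>) = - sign \<pi>"
      using sign_compose_permutes[OF _ that perm] neq by (simp add: sign_swap_id)
    ultimately show ?thesis by (simp add: matching_sign_def)
  qed
  moreover have "matching_monom n (\<pi> \<circ> ?\<rho>) = matching_monom n \<pi>" for \<pi>
    unfolding matching_monom_def
  proof (rule sum.cong[OF refl])
    fix t assume t: "t \<in> {1..n}"
    show "Poly_Mapping.single (min ((\<pi> \<circ> ?\<rho>) (2 * t - 1)) ((\<pi> \<circ> ?\<rho>) (2 * t)),
        max ((\<pi> \<circ> ?\<rho>) (2 * t - 1)) ((\<pi> \<circ> ?\<rho>) (2 * t))) 1 =
      Poly_Mapping.single (min (\<pi> (2 * t - 1)) (\<pi> (2 * t)), max (\<pi> (2 * t - 1)) (\<pi> (2 * t))) 1"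
      unfolding comp_apply val[OF t] by (simp add: min.commute max.commute)
  qed
  ultimately show ?thesis using perm by (simp add: block_perms_def)
qed

lemma block_swap_apply:
  assumes "1 \<le> s" "1 \<le> t"
  shows "(transpose (2 * s - 1) (2 * s + 1) \<circ> transpose (2 * s) (2 * s + 2)) (2 * t - 1) =
      2 * transpose s (Suc s) t - 1"
    and "(transpose (2 * s - 1) (2 * s + 1) \<circ> transpose (2 * s) (2 * s + 2)) (2 * t) =
      2 * transpose s (Suc s) t"
proof -
  obtain a b where "s = Suc a" "t = Suc b"
    using assms by (metis Suc_le_D One_nat_def)
  then show "(transpose (2 * s - 1) (2 * s + 1) \<circ> transpose (2 * s) (2 * s + 2)) (2 * t - 1) =
      2 * transpose s (Suc s) t - 1"
    and "(transpose (2 * s - 1) (2 * s + 1) \<circ> transpose (2 * s) (2 * s + 2)) (2 * t) =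
      2 * transpose s (Suc s) t"
    by (simp_all add: transpose_def) presburger
qed

text \<open>Exchanging two whole blocks takes two transpositions, hence is even, and it merely
  reindexes the product of signs and the sum of exponents.\<close>

lemma block_swap:
  assumes "s \<in> {1..<n}"
  shows "transpose (2 * s - 1) (2 * s + 1) \<circ> transpose (2 * s) (2 * s + 2) \<in> block_perms n"
    (is "?\<rho> \<in> _")
proof -
  have perms: "transpose (2 * s - 1) (2 * s + 1) permutes {1..2 * n}"
      "transpose (2 * s) (2 * s + 2) permutes {1..2 * n}"
    using assms by (auto intro!: permutes_swap_id)
  note perm = permutes_compose[OF perms(2,1)]
  have val: "?\<rho> (2 * t - 1) = 2 * transpose s (Suc s) t - 1"
      "?\<rho> (2 * t) = 2 * transpose s (Suc s) t" if "t \<in> {1..n}" for t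
    using that assms block_swap_apply[of s t] by simp_all
  have idx: "transpose s (Suc s) permutes {1..n}"
    using assms by (intro permutes_swap_id) auto
  have "sign ?\<rho> = 1"
    using sign_compose_permutes[OF _ perms] assms by (auto simp: sign_swap_id)
  then have sgn: "sign (\<pi> \<circ> ?\<rho>) = sign \<pi>" if "\<pi> permutes {1..2 * n}" for \<pi>
    using sign_compose_permutes[OF _ that perm] by simp
  have "(\<Prod>t = 1..n. sgn (int ((\<pi> \<circ> ?\<rho>) (2 * t)) - int ((\<pi> \<circ> ?\<rho>) (2 * t - 1)))) =
      (\<Prod>t = 1..n. sgn (int (\<pi> (2 * t)) - int (\<pi> (2 * t - 1))))" for \<pi>
    by (subst (2) prod.permute[OF idx], rule prod.cong) (simp_all only: comp_def[of \<pi>] val, simp)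
  moreover have "matching_monom n (\<pi> \<circ> ?\<rho>) = matching_monom n \<pi>" for \<pi>
    unfolding matching_monom_def
    by (subst (2) sum.permute[OF idx], rule sum.cong) (simp_all only: comp_def[of \<pi>] val, simp)
  ultimately show ?thesis
    using perm sgn by (simp add: block_perms_def matching_sign_def)
qed

section \<open>Sorting a matching into Pfaff form\<close>

lemma strict_mono_on_interval:
  fixes f :: "nat \<Rightarrow> 'a::order"
  assumes "\<And>s. a \<le> s \<Longrightarrow> s < b \<Longrightarrow> f s < f (Suc s)"
  shows "strict_mono_on {a..b} f"
proof (rule strict_mono_onI)
  fix r s assume "r \<in> {a..b}" "s \<in> {a..b}" "r < s"
  from \<open>r < s\<close> have "Suc r \<le> s" by simp
  then show "f r < f s" using \<open>r \<in> _\<close> \<open>s \<in> _\<close>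
  proof (induction s rule: dec_induct)
    case base
    then show ?case by (simp add: assms)
  next
    case (step t)
    then have "f r < f t" "f t < f (Suc t)" by (auto intro: assms)
    then show ?case by (rule less_trans)
  qed
qed

lemma pfaff_normal_form:
  assumes \<pi>: "\<pi> permutes {1..2 * n}"
  obtains \<rho> where "\<rho> \<in> block_perms n" "\<pi> \<circ> \<rho> \<in> pfaff_perms n"
proof -
  \<comment> \<open>Flips and swaps of adjacent blocks that repair a violation of the Pfaff conditions
    strictly increase \<open>M\<close>, so a maximizer of \<open>M\<close> is a Pfaff permutation.\<close>
  define lo where "lo = (\<lambda>\<tau> t :: nat. min (\<tau> (2 * t - 1)) (\<tau> (2 * t) :: nat))"
  define up where "up = (\<lambda>\<tau> t :: nat. if \<tau> (2 * t - 1) < (\<tau> (2 * t) :: nat) then 1 else 0 :: nat)"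
  define M where "M = (\<lambda>\<tau>. (\<Sum>t = 1..n. t * lo \<tau> t) + (\<Sum>t = 1..n. up \<tau> t))"
  have "finite (block_perms n)"
    by (rule finite_subset[OF _ finite_permutations[of "{1..2 * n}"]]) (auto simp: block_perms_def)
  then obtain \<rho> where \<rho>: "\<rho> \<in> block_perms n"
      and max: "\<And>\<rho>'. \<rho>' \<in> block_perms n \<Longrightarrow> M (\<pi> \<circ> \<rho>') \<le> M (\<pi> \<circ> \<rho>)"
  proof (rule obtains_MAX)
    show "block_perms n \<noteq> {}" using block_perms_id[of n] by blast
    fix \<rho> assume "\<rho> \<in> block_perms n" "(MAX \<rho> \<in> block_perms n. M (\<pi> \<circ> \<rho>)) = M (\<pi> \<circ> \<rho>)"
    with \<open>finite (block_perms n)\<close> show thesis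
      by (intro that) (auto simp flip: \<open>_ = M (\<pi> \<circ> \<rho>)\<close>)
  qed
  define \<tau> where "\<tau> = \<pi> \<circ> \<rho>"
  have \<tau>: "\<tau> permutes {1..2 * n}"
    using \<rho> \<pi> unfolding \<tau>_def block_perms_def by (auto intro: permutes_compose)
  have max: "M (\<tau> \<circ> \<rho>') \<le> M \<tau>" if "\<rho>' \<in> block_perms n" for \<rho>'
    using max[OF block_perms_comp[OF \<rho> that]] by (simp add: \<tau>_def comp_assoc)
  have ord: "\<tau> (2 * s - 1) < \<tau> (2 * s)" if s: "s \<in> {1..n}" for s
  proof (rule ccontr)
    assume *: "\<not> ?thesis"
    let ?f = "transpose (2 * s - 1) (2 * s)"
    have val: "?f (2 * t - 1) = (if t = s then 2 * t else 2 * t - 1)"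
      "?f (2 * t) = (if t = s then 2 * t - 1 else 2 * t)" if "t \<in> {1..n}" for t
      using that s block_flip_apply[of s t] by simp_all
    have "2 * s - 1 \<noteq> 2 * s" using s by auto
    then have "\<tau> (2 * s - 1) \<noteq> \<tau> (2 * s)"
      using permutes_inj[OF \<tau>] by (metis injD)
    with * have gt: "\<tau> (2 * s) < \<tau> (2 * s - 1)" by simp
    have "(\<Sum>t = 1..n. t * lo (\<tau> \<circ> ?f) t) = (\<Sum>t = 1..n. t * lo \<tau> t)"
    proof (rule sum.cong[OF refl])
      fix t assume t: "t \<in> {1..n}"
      show "t * lo (\<tau> \<circ> ?f) t = t * lo \<tau> t"
        unfolding lo_def comp_apply val[OF t] by (simp add: min.commute)
    qed
    moreover have "(\<Sum>t = 1..n. up \<tau> t) < (\<Sum>t = 1..n. up (\<tau> \<circ> ?f) t)"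
    proof (rule sum_strict_mono_ex1)
      have "up (\<tau> \<circ> ?f) t = (if t = s then 1 else up \<tau> t)" if "t \<in> {1..n}" for t
        unfolding up_def comp_apply val[OF that] using gt by simp
      moreover have "up \<tau> s = 0" using gt by (simp add: up_def)
      ultimately show "\<forall>t \<in> {1..n}. up \<tau> t \<le> up (\<tau> \<circ> ?f) t"
        "\<exists>t \<in> {1..n}. up \<tau> t < up (\<tau> \<circ> ?f) t"
        using s by (auto simp del: One_nat_def)
    qed simp
    ultimately have "M \<tau> < M (\<tau> \<circ> ?f)" by (simp add: M_def)
    with max[OF block_flip[OF s]] show False by simp
  qed
  have "\<tau> (2 * s - 1) < \<tau> (2 * Suc s - 1)" if s: "1 \<le> s" "s < n" for s
  proof (rule ccontr)
    assume *: "\<not> ?thesis"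
    let ?f = "transpose (2 * s - 1) (2 * s + 1) \<circ> transpose (2 * s) (2 * s + 2)"
    let ?\<theta> = "transpose s (Suc s)"
    have idx: "?\<theta> permutes {1..n}"
      using s by (intro permutes_swap_id) auto
    have val: "?f (2 * t - 1) = 2 * ?\<theta> t - 1" "?f (2 * t) = 2 * ?\<theta> t" if "t \<in> {1..n}" for t
      using that s block_swap_apply[of s t] by simp_all
    have "2 * s - 1 \<noteq> 2 * Suc s - 1" using s by auto
    then have "\<tau> (2 * s - 1) \<noteq> \<tau> (2 * Suc s - 1)"
      using permutes_inj[OF \<tau>] by (metis injD)
    with * have gt: "\<tau> (2 * Suc s - 1) < \<tau> (2 * s - 1)" by simp
    \<comment> \<open>All blocks are increasing by \<open>ord\<close>, so their minima are their
      first entries.\<close>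
    have lo: "lo \<tau> s = \<tau> (2 * s - 1)" "lo \<tau> (Suc s) = \<tau> (2 * Suc s - 1)"
      using ord[of s] ord[of "Suc s"] s by (auto simp: lo_def)
    have up_eq: "(\<Sum>t = 1..n. up (\<tau> \<circ> ?f) t) = (\<Sum>t = 1..n. up \<tau> t)"
      by (subst (2) sum.permute[OF idx], rule sum.cong)
         (simp_all only: up_def comp_def[of \<tau>] val, simp)
    have "lo (\<tau> \<circ> ?f) t = lo \<tau> (?\<theta> t)" if "t \<in> {1..n}" for t
      by (simp only: lo_def comp_def[of \<tau>] val[OF that])
    then have "(\<Sum>t = 1..n. t * lo (\<tau> \<circ> ?f) t) = (\<Sum>t = 1..n. t * lo \<tau> (?\<theta> t))"
      by simp
    also have "\<dots> = (\<Sum>t \<in> {1..n} - {s, Suc s}. t * lo \<tau> (?\<theta> t)) +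
        (s * lo \<tau> (Suc s) + Suc s * lo \<tau> s)"
      by (subst sum.subset_diff[of "{s, Suc s}"]) (use s in auto)
    also have "(\<Sum>t \<in> {1..n} - {s, Suc s}. t * lo \<tau> (?\<theta> t)) =
        (\<Sum>t \<in> {1..n} - {s, Suc s}. t * lo \<tau> t)"
      by (rule sum.cong) (auto simp: transpose_def)
    finally have swapped: "(\<Sum>t = 1..n. t * lo (\<tau> \<circ> ?f) t) =
        (\<Sum>t \<in> {1..n} - {s, Suc s}. t * lo \<tau> t) + (s * lo \<tau> (Suc s) + Suc s * lo \<tau> s)" .
    have "(\<Sum>t = 1..n. t * lo \<tau> t) =
        (\<Sum>t \<in> {1..n} - {s, Suc s}. t * lo \<tau> t) + (s * lo \<tau> s + Suc s * lo \<tau> (Suc s))"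
      by (subst sum.subset_diff[of "{s, Suc s}"]) (use s in auto)
    \<comment> \<open>The gain is exactly the difference of the two minima.\<close>
    moreover have "s * lo \<tau> s + Suc s * lo \<tau> (Suc s) < s * lo \<tau> (Suc s) + Suc s * lo \<tau> s"
      using gt unfolding lo by simp
    ultimately have "M \<tau> < M (\<tau> \<circ> ?f)"
      unfolding M_def up_eq swapped by linarith
    with max[OF block_swap[of s n]] s show False by simp
  qed
  then have "\<tau> \<in> pfaff_perms n"
    unfolding pfaff_perms_def using \<tau> ord by (auto intro: strict_mono_on_interval)
  with \<rho> show ?thesis unfolding \<tau>_def by (rule that)
qed

section \<open>Pfaff permutations are determined by their monomials\<close>

text \<open>Natural exponents cannot cancel, so the support of the sum is the union of the supports.
  Thus a monomial determines its edge set, which behaves well under relabelling of vertices.\<close>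

lemma matching_edges_eq_keys:
  "matching_edges n \<pi> = (\<lambda>(i, j). {i, j}) ` Poly_Mapping.keys (matching_monom n \<pi>)"
proof -
  let ?e = "\<lambda>s. (min (\<pi> (2 * s - 1)) (\<pi> (2 * s)), max (\<pi> (2 * s - 1)) (\<pi> (2 * s)))"
  have "Poly_Mapping.keys (\<Sum>s \<in> A. Poly_Mapping.single (?e s) (1 :: nat)) = ?e ` A"
    if "finite A" for A
    using that
  proof (induction A)
    case (insert a A)
    have "Poly_Mapping.keys (p + q) = Poly_Mapping.keys p \<union> Poly_Mapping.keys q"
      for p q :: "nat \<times> nat \<Rightarrow>\<^sub>0 nat"
      by (auto simp: in_keys_iff lookup_add)
    with insert show ?case by simp
  qed simp
  then have "Poly_Mapping.keys (matching_monom n \<pi>) = ?e ` {1..n}"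
    by (simp add: matching_monom_def)
  then have "(\<lambda>(i, j). {i, j}) ` Poly_Mapping.keys (matching_monom n \<pi>) =
      (\<lambda>s. {\<pi> (2 * s - 1), \<pi> (2 * s)}) ` {1..n}"
    by (simp only: image_image prod.case) (intro image_cong, auto simp: min_def max_def)
  then show ?thesis by (simp only: matching_edges_def)
qed

lemma matching_edges_comp: "matching_edges n (\<tau> \<circ> \<pi>) = (`) \<tau> ` matching_edges n \<pi>"
  by (simp add: matching_edges_def image_image)

text \<open>The two lists of values are strictly sorted with the same elements, hence equal.\<close>

lemma strict_mono_on_same_image:
  fixes f g :: "nat \<Rightarrow> 'a::linorder"
  assumes "strict_mono_on {1..n} f" "strict_mono_on {1..n} g" "f ` {1..n} = g ` {1..n}" "s \<in> {1..n}"
  shows "f s = g s"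
proof -
  have "sorted_wrt (<) (map h [1..<Suc n])"
    if "strict_mono_on {1..n} h" for h :: "nat \<Rightarrow> 'a"
    unfolding sorted_wrt_map
    by (rule sorted_wrt_mono_rel[OF _ sorted_wrt_upt]) (use that in \<open>auto simp: strict_mono_on_def\<close>)
  then have "map f [1..<Suc n] = map g [1..<Suc n]"
    by (intro strict_sorted_equal)
       (use assms in \<open>auto simp del: upt_Suc simp: atLeastLessThanSuc_atLeastAtMost\<close>)
  then show ?thesis using assms(4) by (auto simp del: upt_Suc)
qed

text \<open>The first entries of the blocks are the minima of the edges in increasing order, so the
  edge set determines them; the second entries are their partners.\<close>

lemma pfaff_perms_edges_inj:
  assumes "\<pi> \<in> pfaff_perms n" "\<pi>' \<in> pfaff_perms n" "matching_edges n \<pi> = matching_edges n \<pi>'"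
  shows "\<pi> = \<pi>'"
proof
  have Min: "Min ` matching_edges n \<tau> = (\<lambda>s. \<tau> (2 * s - 1)) ` {1..n}" if "\<tau> \<in> pfaff_perms n" for \<tau>
    unfolding matching_edges_def image_image
    by (rule image_cong) (use that in \<open>auto simp: pfaff_perms_def min_def dest!: bspec\<close>)
  have mono: "strict_mono_on {1..n} (\<lambda>s. \<pi> (2 * s - 1))" "strict_mono_on {1..n} (\<lambda>s. \<pi>' (2 * s - 1))"
    using assms by (auto simp: pfaff_perms_def)
  have odd: "\<pi> (2 * s - 1) = \<pi>' (2 * s - 1)" if "s \<in> {1..n}" for s
    using strict_mono_on_same_image[OF mono _ that] Min assms by metis
  have even: "\<pi> (2 * s) = \<pi>' (2 * s)" if s: "s \<in> {1..n}" for s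
  proof -
    have "{\<pi> (2 * s - 1), \<pi> (2 * s)} \<in> matching_edges n \<pi>'"
      using s assms(3)[symmetric] by (simp only: matching_edges_def) (rule imageI)
    then obtain t where t: "t \<in> {1..n}" "{\<pi> (2 * s - 1), \<pi> (2 * s)} = {\<pi>' (2 * t - 1), \<pi>' (2 * t)}"
      by (auto simp: matching_edges_def)
    moreover have "\<pi> (2 * s - 1) < \<pi> (2 * s)" "\<pi>' (2 * t - 1) < \<pi>' (2 * t)"
      using assms(1,2) s t(1) by (auto simp: pfaff_perms_def)
    ultimately have eq: "\<pi> (2 * s - 1) = \<pi>' (2 * t - 1)" "\<pi> (2 * s) = \<pi>' (2 * t)"
      by (auto simp: doubleton_eq_iff)
    then have "s = t"
      using odd[OF s] strict_mono_on_imp_inj_on[OF mono(2)] s t(1) by (auto dest: inj_onD)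
    with eq show ?thesis by simp
  qed
  fix i
  consider "i \<notin> {1..2 * n}" | s where "s \<in> {1..n}" "i = 2 * s - 1" | s where "s \<in> {1..n}" "i = 2 * s"
  proof (cases "i \<in> {1..2 * n}")
    case True
    show ?thesis
    proof (cases "even i")
      case True
      then obtain k where "i = 2 * k" by (rule evenE)
      with \<open>i \<in> _\<close> show ?thesis using that(3)[of k] by auto
    next
      case False
      then obtain k where "i = 2 * k + 1" by (rule oddE)
      with \<open>i \<in> _\<close> show ?thesis using that(2)[of "Suc k"] by auto
    qed
  qed (use that in blast)
  then show "\<pi> i = \<pi>' i"
  proof cases
    case 1
    moreover have "\<pi> permutes {1..2 * n}" "\<pi>' permutes {1..2 * n}"
      using assms(1,2) by (simp_all only: pfaff_perms_def mem_Collect_eq)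
    ultimately show ?thesis by (metis permutes_not_in)
  qed (use odd even in auto)
qed

lemma finite_pfaff_perms: "finite (pfaff_perms n)"
  by (rule finite_subset[OF _ finite_permutations[of "{1..2 * n}"]]) (auto simp: pfaff_perms_def)

text \<open>Excludes collisions between the terms of the Pfaffian, and also between those of its
  image under a permutation, where \<open>\<tau>\<close> is the inverse of that permutation.\<close>

lemma pfaff_perms_monom_inj:
  assumes "inj \<tau>" "\<pi> \<in> pfaff_perms n" "\<pi>' \<in> pfaff_perms n"
    "matching_monom n (\<tau> \<circ> \<pi>) = matching_monom n (\<tau> \<circ> \<pi>')"
  shows "\<pi> = \<pi>'"
proof (rule pfaff_perms_edges_inj[OF assms(2,3)])
  have "(`) \<tau> ` matching_edges n \<pi> = (`) \<tau> ` matching_edges n \<pi>'"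
    using assms(4) matching_edges_eq_keys by (metis matching_edges_comp)
  moreover have "inj ((`) \<tau>)" using assms(1) by (simp add: inj_on_def inj_image_eq_iff)
  ultimately show "matching_edges n \<pi> = matching_edges n \<pi>'" by (simp add: inj_image_eq_iff)
qed

lemma matching_sign_pfaff: "\<pi> \<in> pfaff_perms n \<Longrightarrow> matching_sign n \<pi> = sign \<pi>"
  by (auto simp: matching_sign_def pfaff_perms_def intro!: prod.neutral)

subsection \<open>Coefficients of the Pfaffian\<close>

text \<open>In normal form the value is the sign of a permutation; in particular no
  \<open>sgn\<close> factor vanishes.\<close>

lemma matching_sign_cases:
  assumes "\<pi> permutes {1..2 * n}"
  shows "matching_sign n \<pi> = 1 \<or> matching_sign n \<pi> = -1"
proof -
  obtain \<rho> where \<rho>: "\<rho> \<in> block_perms n" "\<pi> \<circ> \<rho> \<in> pfaff_perms n"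
    using pfaff_normal_form[OF assms] .
  then have "matching_sign n \<pi> = sign (\<pi> \<circ> \<rho>)"
    using assms matching_sign_pfaff by (auto simp: block_perms_def)
  then show ?thesis by (cases "\<pi> \<circ> \<rho>" rule: sign_cases) auto
qed

lemma prod_gen_eq_single:
  "(\<Prod>s = 1..n. gen (\<pi> (2 * s - 1)) (\<pi> (2 * s)) :: 'k::field pol) =
    Poly_Mapping.single (matching_monom n \<pi>) 1"
proof -
  have "(\<Prod>s \<in> A. Poly_Mapping.single (f s) (1 :: 'k)) = Poly_Mapping.single (\<Sum>s \<in> A. f s) 1"
    for A and f :: "nat \<Rightarrow> (nat \<times> nat) \<Rightarrow>\<^sub>0 nat"
    by (induction A rule: infinite_finite_induct) (simp_all add: mult_single)
  then show ?thesis by (simp only: gen_def var_def matching_monom_def)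
qed

lemma pf_eq_sum_single:
  "pf n = (\<Sum>\<pi> \<in> pfaff_perms n. of_int (sign \<pi>) * Poly_Mapping.single (matching_monom n \<pi>) (1 :: 'k::field))"
  by (simp only: pf_def prod_gen_eq_single)

lemma act_pf:
  "act \<sigma> (pf n) = (\<Sum>\<pi> \<in> pfaff_perms n. of_int (sign \<pi>) *
     Poly_Mapping.single (matching_monom n (inv_into UNIV \<sigma> \<circ> \<pi>)) (1 :: 'k::field))"
proof -
  have "act \<sigma> (\<Sum>x \<in> A. g x) = (\<Sum>x \<in> A. act \<sigma> (g x :: 'k pol))" for A :: "(nat \<Rightarrow> nat) set" and g
    by (simp add: act_def subst_sum)
  moreover have "act \<sigma> (\<Prod>x \<in> A. g x) = (\<Prod>x \<in> A. act \<sigma> (g x :: 'k pol))" for A :: "nat set" and g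
    by (simp add: act_def subst_prod)
  moreover have "act \<sigma> (of_int k) = (of_int k :: 'k pol)" for k
    by (simp add: of_int_const act_const)
  ultimately show ?thesis
    by (simp only: pf_def act_mult act_gen prod_gen_eq_single[symmetric] comp_apply)
qed

text \<open>By injectivity of the monomials only the summand of \<open>\<pi>\<close> contributes to
  this coefficient.\<close>

lemma lookup_signed_sum:
  assumes "inj \<tau>" "\<pi> \<in> pfaff_perms n"
  shows "Poly_Mapping.lookup (\<Sum>\<pi> \<in> pfaff_perms n. of_int (sign \<pi>) *
      Poly_Mapping.single (matching_monom n (\<tau> \<circ> \<pi>)) (1 :: 'k::field)) (matching_monom n (\<tau> \<circ> \<pi>)) =
    of_int (sign \<pi>)"
proof -
  have single: "of_int k * Poly_Mapping.single m (1 :: 'k) = Poly_Mapping.single m (of_int k)"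
    for k and m :: "(nat \<times> nat) \<Rightarrow>\<^sub>0 nat"
    by (simp only: of_int_const const_def mult_single add_0_left mult_1_right)
  have eq: "matching_monom n (\<tau> \<circ> \<pi>') = matching_monom n (\<tau> \<circ> \<pi>) \<longleftrightarrow> \<pi>' = \<pi>"
    if "\<pi>' \<in> pfaff_perms n" for \<pi>'
    using pfaff_perms_monom_inj[OF assms(1) that assms(2)] by blast
  have "(\<Sum>\<pi>' \<in> pfaff_perms n. Poly_Mapping.lookup
      (Poly_Mapping.single (matching_monom n (\<tau> \<circ> \<pi>')) (of_int (sign \<pi>') :: 'k)) (matching_monom n (\<tau> \<circ> \<pi>))) =
    (\<Sum>\<pi>' \<in> pfaff_perms n. if \<pi>' = \<pi> then of_int (sign \<pi>') else 0)"
    by (rule sum.cong[OF refl]) (simp only: lookup_single when_def eq)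
  also have "\<dots> = of_int (sign \<pi>)"
    using assms(2) by (simp add: sum.delta finite_pfaff_perms)
  finally show ?thesis
    by (simp only: single lookup_sum)
qed

text \<open>Passing to the normal form changes neither the monomial nor the matching sign, so the
  coefficient can be read off at a Pfaff permutation.\<close>

lemma lookup_pf:
  assumes "\<pi> permutes {1..2 * n}"
  shows "Poly_Mapping.lookup (pf n :: 'k::field pol) (matching_monom n \<pi>) = of_int (matching_sign n \<pi>)"
proof -
  obtain \<rho> where \<rho>: "\<rho> \<in> block_perms n" "\<pi> \<circ> \<rho> \<in> pfaff_perms n"
    using pfaff_normal_form[OF assms] .
  then have "matching_monom n \<pi> = matching_monom n (\<pi> \<circ> \<rho>)" "matching_sign n \<pi> = sign (\<pi> \<circ> \<rho>)"
    using assms matching_sign_pfaff by (auto simp: block_perms_def)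
  with lookup_signed_sum[OF inj_on_id \<rho>(2), where 'k = 'k] show ?thesis
    by (simp add: pf_eq_sum_single)
qed

section \<open>Symmetries of the Pfaffian as sign preserving permutations\<close>

text \<open>A description of the symmetry group that does not mention the field; it separates the
  algebra from the combinatorics.\<close>

definition sign_preserving :: "nat \<Rightarrow> (nat \<Rightarrow> nat) set" where
  "sign_preserving n = {\<sigma>. \<sigma> permutes {1..2 * n} \<and>
     (\<forall>\<pi>. \<pi> permutes {1..2 * n} \<longrightarrow> matching_sign n (\<sigma> \<circ> \<pi>) = matching_sign n \<pi>)}"

lemma of_int_unit_eqD:
  assumes "CHAR('k::field) \<noteq> 2" "of_int a = (of_int b :: 'k)" "a = 1 \<or> a = -1" "b = 1 \<or> b = -1"
  shows "a = b"
proof (rule ccontr)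
  assume "a \<noteq> b"
  with assms(2-4) have "(1 :: 'k) = - 1" by auto
  then have "of_nat 2 = (0 :: 'k)" by (simp add: eq_neg_iff_add_eq_0)
  then have "CHAR('k) dvd 2" by (simp only: of_nat_eq_0_iff_char_dvd)
  then have "CHAR('k) \<le> 2" "CHAR('k) \<noteq> 0"
    by (simp add: dvd_imp_le) (metis \<open>CHAR('k) dvd 2\<close> dvd_0_left_iff zero_neq_numeral)
  \<comment> \<open>The characteristic divides 2 and is not 2; the remaining value 1 is impossible
    in a field.\<close>
  with assms(1) have "CHAR('k) = Suc 0" by linarith
  then show False by simp
qed

text \<open>Compare the coefficients at the monomial of
  \<open>inv_into UNIV \<sigma> \<circ> \<pi>\<close>: the image of the Pfaffian has
  \<open>sign \<pi>\<close>, the Pfaffian itself the matching sign. Signs that agree in the field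
  agree as integers because the characteristic is not 2.\<close>

lemma Sym_pf_subset:
  assumes "CHAR('k::field) \<noteq> 2"
  shows "Sym n (pf n :: 'k pol) \<subseteq> sign_preserving n"
proof
  fix \<sigma> assume "\<sigma> \<in> Sym n (pf n :: 'k pol)"
  then have \<sigma>: "\<sigma> permutes {1..2 * n}" and fixed: "act \<sigma> (pf n) = (pf n :: 'k pol)"
    by (auto simp: Sym_def sym_group_carrier)
  note inv = permutes_inv[OF \<sigma>]
  have eq: "matching_sign n (inv_into UNIV \<sigma> \<circ> \<pi>) = sign \<pi>" if \<pi>: "\<pi> \<in> pfaff_perms n" for \<pi>
  proof -
    have perm: "inv_into UNIV \<sigma> \<circ> \<pi> permutes {1..2 * n}"
      using \<pi> inv by (auto simp: pfaff_perms_def intro: permutes_compose)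
    have "of_int (sign \<pi>) = Poly_Mapping.lookup (act \<sigma> (pf n) :: 'k pol) (matching_monom n (inv_into UNIV \<sigma> \<circ> \<pi>))"
      unfolding act_pf by (rule lookup_signed_sum[OF permutes_inj[OF inv] \<pi>, symmetric])
    also have "\<dots> = of_int (matching_sign n (inv_into UNIV \<sigma> \<circ> \<pi>))"
      unfolding fixed by (rule lookup_pf[OF perm])
    finally show ?thesis
      using of_int_unit_eqD[OF assms] matching_sign_cases[OF perm]
      by (metis sign_cases)
  qed
  \<comment> \<open>\<open>eq\<close> concerns Pfaff permutations only; it is applied to the normal
    form of \<open>\<sigma> \<circ> \<pi>\<close>.\<close>
  have "matching_sign n (\<sigma> \<circ> \<pi>) = matching_sign n \<pi>" if \<pi>: "\<pi> permutes {1..2 * n}" for \<pi>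
  proof -
    have \<sigma>\<pi>: "\<sigma> \<circ> \<pi> permutes {1..2 * n}" by (rule permutes_compose[OF \<pi> \<sigma>])
    obtain \<rho> where \<rho>: "\<rho> \<in> block_perms n" "\<sigma> \<circ> \<pi> \<circ> \<rho> \<in> pfaff_perms n"
      using pfaff_normal_form[OF \<sigma>\<pi>] .
    have "matching_sign n (\<sigma> \<circ> \<pi>) = matching_sign n (\<sigma> \<circ> \<pi> \<circ> \<rho>)"
      using \<rho>(1) \<sigma>\<pi> by (simp add: block_perms_def)
    also have "\<dots> = matching_sign n (inv_into UNIV \<sigma> \<circ> (\<sigma> \<circ> \<pi> \<circ> \<rho>))"
      using eq[OF \<rho>(2)] matching_sign_pfaff[OF \<rho>(2)] by simp
    also have "inv_into UNIV \<sigma> \<circ> (\<sigma> \<circ> \<pi> \<circ> \<rho>) = \<pi> \<circ> \<rho>"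
      by (simp add: permutes_inv_o(2)[OF \<sigma>] flip: comp_assoc)
    also have "matching_sign n (\<pi> \<circ> \<rho>) = matching_sign n \<pi>"
      using \<rho>(1) \<pi> by (simp add: block_perms_def)
    finally show ?thesis .
  qed
  with \<sigma> show "\<sigma> \<in> sign_preserving n" by (simp add: sign_preserving_def)
qed

text \<open>The action only reorders the terms: the term of \<open>\<pi>\<close> becomes the term of
  the normal form of \<open>inv_into UNIV \<sigma> \<circ> \<pi>\<close>, which has the same
  sign.\<close>

lemma sign_preserving_subset:
  "sign_preserving n \<subseteq> Sym n (pf n :: 'k::field pol)"
proof
  fix \<sigma> assume "\<sigma> \<in> sign_preserving n"
  then have \<sigma>: "\<sigma> permutes {1..2 * n}"
    and pres: "\<And>\<pi>. \<pi> permutes {1..2 * n} \<Longrightarrow> matching_sign n (\<sigma> \<circ> \<pi>) = matching_sign n \<pi>"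
    by (auto simp: sign_preserving_def)
  let ?\<sigma>' = "inv_into UNIV \<sigma>"
  note inv = permutes_inv[OF \<sigma>]
  have "\<exists>\<pi>' \<in> pfaff_perms n. matching_monom n \<pi>' = matching_monom n (?\<sigma>' \<circ> \<pi>) \<and> sign \<pi>' = sign \<pi>"
    if \<pi>: "\<pi> \<in> pfaff_perms n" for \<pi>
  proof -
    have \<pi>_perm: "\<pi> permutes {1..2 * n}" using \<pi> by (simp add: pfaff_perms_def)
    have perm: "?\<sigma>' \<circ> \<pi> permutes {1..2 * n}" by (rule permutes_compose[OF \<pi>_perm inv])
    obtain \<rho> where \<rho>: "\<rho> \<in> block_perms n" "?\<sigma>' \<circ> \<pi> \<circ> \<rho> \<in> pfaff_perms n"
      using pfaff_normal_form[OF perm] .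
    have "sign (?\<sigma>' \<circ> \<pi> \<circ> \<rho>) = matching_sign n (?\<sigma>' \<circ> \<pi>)"
      using \<rho> perm matching_sign_pfaff[OF \<rho>(2)] by (simp add: block_perms_def)
    also have "\<dots> = matching_sign n (\<sigma> \<circ> (?\<sigma>' \<circ> \<pi>))"
      using pres[OF perm] by simp
    also have "\<sigma> \<circ> (?\<sigma>' \<circ> \<pi>) = \<pi>"
      by (simp add: permutes_inv_o(1)[OF \<sigma>] flip: comp_assoc)
    also have "matching_sign n \<pi> = sign \<pi>" by (rule matching_sign_pfaff[OF \<pi>])
    finally have "sign (?\<sigma>' \<circ> \<pi> \<circ> \<rho>) = sign \<pi>" .
    moreover have "matching_monom n (?\<sigma>' \<circ> \<pi> \<circ> \<rho>) = matching_monom n (?\<sigma>' \<circ> \<pi>)"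
      using \<rho>(1) perm by (simp add: block_perms_def)
    ultimately show ?thesis using \<rho>(2) by blast
  qed
  then obtain c where c: "\<And>\<pi>. \<pi> \<in> pfaff_perms n \<Longrightarrow> c \<pi> \<in> pfaff_perms n"
      "\<And>\<pi>. \<pi> \<in> pfaff_perms n \<Longrightarrow> matching_monom n (c \<pi>) = matching_monom n (?\<sigma>' \<circ> \<pi>)"
      "\<And>\<pi>. \<pi> \<in> pfaff_perms n \<Longrightarrow> sign (c \<pi>) = sign \<pi>"
    by metis
  \<comment> \<open>Distinct Pfaff permutations keep distinct monomials after relabelling; an
    injective self-map of a finite set is bijective, so the sum may be reindexed along
    \<open>c\<close>.\<close>
  have inj: "inj_on c (pfaff_perms n)"
    using c(2) pfaff_perms_monom_inj[OF permutes_inj[OF inv]] by (metis inj_onI)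
  have "c ` pfaff_perms n \<subseteq> pfaff_perms n" using c(1) by blast
  then have bij: "bij_betw c (pfaff_perms n) (pfaff_perms n)"
    using endo_inj_surj[OF finite_pfaff_perms _ inj] inj by (simp add: bij_betw_def)
  have "act \<sigma> (pf n) = (\<Sum>\<pi> \<in> pfaff_perms n.
      of_int (sign (c \<pi>)) * Poly_Mapping.single (matching_monom n (c \<pi>)) (1 :: 'k))"
    unfolding act_pf by (rule sum.cong) (simp_all add: c)
  also have "\<dots> = pf n"
    unfolding pf_eq_sum_single by (rule sum.reindex_bij_betw[OF bij])
  finally show "\<sigma> \<in> Sym n (pf n :: 'k pol)"
    using \<sigma> by (simp add: Sym_def sym_group_carrier)
qed

subsection \<open>The dihedral group preserves matching signs\<close>

lemma sign_preserving_subgroup: "subgroup (sign_preserving n) (sym_group (2 * n))"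
proof (rule group.subgroupI[OF sym_group_is_group])
  show "sign_preserving n \<subseteq> carrier (sym_group (2 * n))"
    by (auto simp: sign_preserving_def sym_group_carrier)
  have "id \<in> sign_preserving n" by (simp add: sign_preserving_def permutes_id)
  then show "sign_preserving n \<noteq> {}" by blast
next
  fix \<sigma> assume "\<sigma> \<in> sign_preserving n"
  then have \<sigma>: "\<sigma> permutes {1..2 * n}"
    and pres: "\<And>\<pi>. \<pi> permutes {1..2 * n} \<Longrightarrow> matching_sign n (\<sigma> \<circ> \<pi>) = matching_sign n \<pi>"
    by (auto simp: sign_preserving_def)
  have "matching_sign n (inv_into UNIV \<sigma> \<circ> \<pi>) = matching_sign n \<pi>" if "\<pi> permutes {1..2 * n}" for \<pi>
    using pres[OF permutes_compose[OF that permutes_inv[OF \<sigma>]]]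
    by (simp add: permutes_inv_o(1)[OF \<sigma>] flip: comp_assoc)
  then show "inv\<^bsub>sym_group (2 * n)\<^esub> \<sigma> \<in> sign_preserving n"
    using \<sigma> by (simp add: sym_group_carrier sign_preserving_def permutes_inv)
next
  fix \<sigma> \<tau> assume "\<sigma> \<in> sign_preserving n" "\<tau> \<in> sign_preserving n"
  then show "\<sigma> \<otimes>\<^bsub>sym_group (2 * n)\<^esub> \<tau> \<in> sign_preserving n"
    by (auto simp: sym_group_mult sign_preserving_def permutes_compose comp_assoc)
qed

section \<open>Signs of the two dihedral generators\<close>

text \<open>The transposition redirects the image of \<open>m\<close> from \<open>1\<close> to
  \<open>Suc m\<close> and closes the longer cycle, which gives the sign of a cycle by
  induction.\<close>

lemma cyc_shift_Suc:
  assumes "1 \<le> m"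
  shows "cyc_shift (Suc m) = transpose 1 (Suc m) \<circ> cyc_shift m"
  using assms by (auto simp: fun_eq_iff cyc_shift_def transpose_def)

lemma sign_cyc_shift:
  assumes "1 \<le> m"
  shows "sign (cyc_shift m) = (- 1) ^ (m - 1)"
  using assms
proof (induction m rule: dec_induct)
  case base
  have "cyc_shift 1 = id" by (auto simp: fun_eq_iff cyc_shift_def)
  then show ?case by simp
next
  case (step m)
  have "transpose 1 (Suc m) permutes {1..Suc m}" "cyc_shift m permutes {1..Suc m}"
    using step permutes_subset[OF cyc_shift_permutes[of m]] by (simp_all add: permutes_swap_id)
  then have "sign (cyc_shift (Suc m)) = - sign (cyc_shift m)"
    using sign_compose_permutes[of "{1..Suc m}"] step by (simp add: cyc_shift_Suc sign_swap_id)
  with step show ?case by (cases m) simp_all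
qed

text \<open>On \<open>{2..m}\<close> the reflected value must grow by one, which the shift achieves;
  the transposition then repairs the images of \<open>1\<close> and \<open>Suc m\<close>.\<close>

lemma reflection_Suc:
  assumes "1 \<le> m"
  shows "reflection (Suc m) = transpose 1 2 \<circ> (cyc_shift (Suc m) \<circ> reflection m)"
proof
  fix i
  consider "i = 0" | "i = 1" | "2 \<le> i" "i \<le> m" | "i = Suc m" | "Suc m < i" by linarith
  then show "reflection (Suc m) i = (transpose 1 2 \<circ> (cyc_shift (Suc m) \<circ> reflection m)) i"
  proof cases
    case 3
    then obtain k where "m = i + k" using le_Suc_ex by blast
    with 3 have "reflection m i = k + 2" "reflection (Suc m) i = k + 3" "k + 2 < Suc m"
      by (simp_all add: reflection_def)
    then show ?thesis by (simp add: cyc_shift_def transpose_def)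
  qed (use assms in \<open>simp_all add: reflection_def cyc_shift_def transpose_def\<close>)
qed

lemma sign_reflection_Suc:
  assumes "1 \<le> m"
  shows "sign (reflection (Suc m)) = (- 1) ^ Suc m * sign (reflection m)"
proof -
  have perms: "transpose 1 2 permutes {1..Suc m}" "cyc_shift (Suc m) permutes {1..Suc m}"
    "reflection m permutes {1..Suc m}"
    using assms permutes_subset[OF reflection_permutes[of m]] cyc_shift_permutes[of "Suc m"]
    by (simp_all add: permutes_swap_id)
  then have "sign (reflection (Suc m)) =
      sign (transpose 1 (2 :: nat)) * (sign (cyc_shift (Suc m)) * sign (reflection m))"
    using sign_compose_permutes[of "{1..Suc m}"] assms permutes_compose[OF perms(3,2)]
    by (simp only: reflection_Suc finite_atLeastAtMost)
  then show ?thesis by (simp add: sign_swap_id sign_cyc_shift)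
qed

text \<open>Enlarging the polygon by two vertices contributes the exponents \<open>2 * n + 1\<close>
  and \<open>2 * n + 2\<close> of \<open>- 1\<close>, together one sign change.\<close>

lemma sign_reflection_even:
  assumes "1 \<le> n"
  shows "sign (reflection (2 * n)) = (- 1) ^ (n - 1)"
  using assms
proof (induction n rule: dec_induct)
  case base
  have "reflection (2 * 1) = id" by (auto simp: fun_eq_iff reflection_def)
  then show ?case by simp
next
  case (step n)
  then show ?case
    using sign_reflection_Suc[of "2 * n"] sign_reflection_Suc[of "Suc (2 * n)"]
    by (cases n) simp_all
qed

section \<open>Effect of the generators on matching signs\<close>

lemma matching_block_of:
  fixes \<pi> :: "nat \<Rightarrow> nat"
  assumes "\<pi> permutes {1..2 * n}" "x \<in> {1..2 * n}"
  obtains s where "s \<in> {1..n}" "\<And>t. t \<in> {1..n} \<Longrightarrow> \<pi> (2 * t - 1) = x \<or> \<pi> (2 * t) = x \<longleftrightarrow> t = s"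
proof
  define y where "y = inv_into UNIV \<pi> x"
  have y: "y \<in> {1..2 * n}" using permutes_in_image[OF permutes_inv[OF assms(1)]] assms(2) by (simp add: y_def)
  \<comment> \<open>Positions \<open>2 * t - 1\<close> and \<open>2 * t\<close> are exactly those
    sent to \<open>t\<close> by this rounding.\<close>
  show "(y + 1) div 2 \<in> {1..n}" using y by auto
  fix t assume "t \<in> {1..n}"
  then have "2 * t - 1 = y \<or> 2 * t = y \<longleftrightarrow> t = (y + 1) div 2"
    using y by auto
  moreover have "\<pi> i = x \<longleftrightarrow> i = y" for i
    unfolding y_def using permutes_inverses[OF assms(1)] by metis
  ultimately show "\<pi> (2 * t - 1) = x \<or> \<pi> (2 * t) = x \<longleftrightarrow> t = (y + 1) div 2" by simp
qed

lemma matching_block_values: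
  fixes \<pi> :: "nat \<Rightarrow> nat"
  assumes "\<pi> permutes {1..2 * n}" "t \<in> {1..n}"
  shows "\<pi> (2 * t - 1) \<in> {1..2 * n}" "\<pi> (2 * t) \<in> {1..2 * n}" "\<pi> (2 * t - 1) \<noteq> \<pi> (2 * t)"
proof -
  have "2 * t - 1 \<in> {1..2 * n}" "2 * t \<in> {1..2 * n}" "2 * t - 1 \<noteq> 2 * t" using assms(2) by auto
  then show "\<pi> (2 * t - 1) \<in> {1..2 * n}" "\<pi> (2 * t) \<in> {1..2 * n}" "\<pi> (2 * t - 1) \<noteq> \<pi> (2 * t)"
    using permutes_in_image[OF assms(1)] permutes_inj[OF assms(1)] by (auto dest: injD)
qed

text \<open>A cycle of even length is odd, and this cancels the single inverted block, the one
  containing \<open>2 * n\<close>.\<close>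

lemma cyc_shift_sign_preserving:
  assumes "1 \<le> n"
  shows "cyc_shift (2 * n) \<in> sign_preserving n"
proof -
  let ?c = "cyc_shift (2 * n)"
  have c: "?c permutes {1..2 * n}" by (rule cyc_shift_permutes) (use assms in simp)
  have c_max: "?c (2 * n) = 1" by (simp add: cyc_shift_def)
  have c_int: "int (?c z) = int z + 1" if "z \<in> {1..2 * n}" "z \<noteq> 2 * n" for z
    using that by (simp add: cyc_shift_def)
  have c_sgn: "sgn (int (?c y) - int (?c x)) =
      (if x = 2 * n \<or> y = 2 * n then - sgn (int y - int x) else sgn (int y - int x))"
    if xy: "x \<in> {1..2 * n}" "y \<in> {1..2 * n}" "x \<noteq> y" for x y
  proof -
    consider "x = 2 * n" "y \<noteq> 2 * n" | "x \<noteq> 2 * n" "y = 2 * n" | "x \<noteq> 2 * n" "y \<noteq> 2 * n"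
      using xy(3) by blast
    then show ?thesis
    proof cases
      case 1
      then show ?thesis using xy c_max c_int[of y] by simp
    next
      case 2
      then show ?thesis using xy c_max c_int[of x] by simp
    next
      case 3
      then show ?thesis using xy c_int[of x] c_int[of y] by simp
    qed
  qed
  have "sign ?c = - 1"
    using assms sign_cyc_shift[of "2 * n"] by (cases n) simp_all
  have "matching_sign n (?c \<circ> \<pi>) = matching_sign n \<pi>" if \<pi>: "\<pi> permutes {1..2 * n}" for \<pi>
  proof -
    obtain s where s: "s \<in> {1..n}"
      "\<And>t. t \<in> {1..n} \<Longrightarrow> \<pi> (2 * t - 1) = 2 * n \<or> \<pi> (2 * t) = 2 * n \<longleftrightarrow> t = s"
      using matching_block_of[OF \<pi>, of "2 * n"] assms by auto
    have "(\<Prod>t = 1..n. sgn (int (?c (\<pi> (2 * t))) - int (?c (\<pi> (2 * t - 1))))) =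
        - (\<Prod>t = 1..n. sgn (int (\<pi> (2 * t)) - int (\<pi> (2 * t - 1))))"
    proof (rule prod_negate_one[OF _ s(1)])
      fix t assume t: "t \<in> {1..n}"
      define x y where "x = \<pi> (2 * t - 1)" and "y = \<pi> (2 * t)"
      have xy: "x \<in> {1..2 * n}" "y \<in> {1..2 * n}" "x \<noteq> y" "x = 2 * n \<or> y = 2 * n \<longleftrightarrow> t = s"
        unfolding x_def y_def by (fact matching_block_values[OF \<pi> t] s(2)[OF t])+
      have "sgn (int (?c y) - int (?c x)) =
          (if t = s then - sgn (int y - int x) else sgn (int y - int x))"
        by (simp only: c_sgn[OF xy(1-3)] xy(4))
      then show "sgn (int (?c (\<pi> (2 * t))) - int (?c (\<pi> (2 * t - 1)))) =
          (if t = s then - sgn (int (\<pi> (2 * t)) - int (\<pi> (2 * t - 1)))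
           else sgn (int (\<pi> (2 * t)) - int (\<pi> (2 * t - 1))))"
        by (simp only: x_def y_def)
    qed simp
    then show ?thesis
      using \<open>sign ?c = - 1\<close> sign_compose_permutes[OF _ c \<pi>] by (simp add: matching_sign_def)
  qed
  with c show ?thesis by (simp add: sign_preserving_def)
qed

lemma reflection_sign_preserving:
  assumes "1 \<le> n"
  shows "reflection (2 * n) \<in> sign_preserving n"
proof -
  let ?r = "reflection (2 * n)"
  have r: "?r permutes {1..2 * n}" by (rule reflection_permutes)
  have r1: "?r 1 = 1" by (simp add: reflection_def)
  have r_int: "int (?r z) = 2 * int n + 2 - int z" if "z \<in> {1..2 * n}" "z \<noteq> 1" for z
    using that by (simp add: reflection_def of_nat_diff)
  \<comment> \<open>The extra minus sign makes the block at \<open>1\<close> the only exceptional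
    one, so that \<open>prod_negate_one\<close> applies.\<close>
  have r_sgn: "- sgn (int (?r y) - int (?r x)) =
      (if x = 1 \<or> y = 1 then - sgn (int y - int x) else sgn (int y - int x))"
    if xy: "x \<in> {1..2 * n}" "y \<in> {1..2 * n}" "x \<noteq> y" for x y
  proof -
    consider "x = 1" "y \<noteq> 1" | "x \<noteq> 1" "y = 1" | "x \<noteq> 1" "y \<noteq> 1" using xy(3) by blast
    then show ?thesis
    proof cases
      case 1
      then show ?thesis using xy r1 r_int[of y] by auto
    next
      case 2
      then show ?thesis using xy r1 r_int[of x] by auto
    next
      case 3
      then show ?thesis using xy r_int[of x] r_int[of y] by (auto simp: sgn_if)
    qed
  qed
  have "matching_sign n (?r \<circ> \<pi>) = matching_sign n \<pi>" if \<pi>: "\<pi> permutes {1..2 * n}" for \<pi>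
  proof -
    obtain s where s: "s \<in> {1..n}"
      "\<And>t. t \<in> {1..n} \<Longrightarrow> \<pi> (2 * t - 1) = 1 \<or> \<pi> (2 * t) = 1 \<longleftrightarrow> t = s"
      using matching_block_of[OF \<pi>, of 1] assms by auto
    have "(\<Prod>t = 1..n. - sgn (int (?r (\<pi> (2 * t))) - int (?r (\<pi> (2 * t - 1))))) =
        - (\<Prod>t = 1..n. sgn (int (\<pi> (2 * t)) - int (\<pi> (2 * t - 1))))"
    proof (rule prod_negate_one[OF _ s(1)])
      fix t assume t: "t \<in> {1..n}"
      define x y where "x = \<pi> (2 * t - 1)" and "y = \<pi> (2 * t)"
      have xy: "x \<in> {1..2 * n}" "y \<in> {1..2 * n}" "x \<noteq> y" "x = 1 \<or> y = 1 \<longleftrightarrow> t = s"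
        unfolding x_def y_def by (fact matching_block_values[OF \<pi> t] s(2)[OF t])+
      have "- sgn (int (?r y) - int (?r x)) =
          (if t = s then - sgn (int y - int x) else sgn (int y - int x))"
        by (simp only: r_sgn[OF xy(1-3)] xy(4))
      then show "- sgn (int (?r (\<pi> (2 * t))) - int (?r (\<pi> (2 * t - 1)))) =
          (if t = s then - sgn (int (\<pi> (2 * t)) - int (\<pi> (2 * t - 1)))
           else sgn (int (\<pi> (2 * t)) - int (\<pi> (2 * t - 1))))"
        by (simp only: x_def y_def)
    qed simp
    \<comment> \<open>Of the \<open>n\<close> inserted minus signs one matches the exceptional
      block; the other \<open>n - 1\<close> match the sign of the reflection.\<close>
    moreover have "(\<Prod>t = 1..n. - f t) = - ((- 1) ^ (n - 1) * (\<Prod>t = 1..n. f t))" for f :: "nat \<Rightarrow> int"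
    proof -
      have "(- 1 :: int) ^ n = - ((- 1) ^ (n - 1))" using assms by (cases n) simp_all
      then show ?thesis by (simp add: prod_uminus)
    qed
    ultimately have "(- 1) ^ (n - 1) * (\<Prod>t = 1..n. sgn (int (?r (\<pi> (2 * t))) - int (?r (\<pi> (2 * t - 1))))) =
        (\<Prod>t = 1..n. sgn (int (\<pi> (2 * t)) - int (\<pi> (2 * t - 1))))"
      by (simp only: neg_equal_iff_equal)
    then show ?thesis
      using sign_reflection_even[OF assms] sign_compose_permutes[OF _ r \<pi>]
      by (simp add: matching_sign_def)
  qed
  with r show ?thesis by (simp add: sign_preserving_def)
qed

subsection \<open>Every sign preserving permutation is dihedral\<close>

text \<open>Each transposition corrects one more value and, by distinctness, spares those already
  set; all of them act on \<open>{2..m}\<close>, so \<open>1\<close> stays fixed.\<close>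

lemma permutation_with_prescribed_values:
  fixes b c d m :: nat
  assumes "4 \<le> m" "b \<in> {2..m}" "c \<in> {2..m}" "d \<in> {2..m}" "b \<noteq> c" "b \<noteq> d" "c \<noteq> d"
  obtains \<pi> where "\<pi> permutes {1..m}" "\<pi> 1 = 1" "\<pi> 2 = b" "\<pi> 3 = c" "\<pi> 4 = d"
proof -
  define \<pi>\<^sub>1 where "\<pi>\<^sub>1 = transpose 2 b"
  define \<pi>\<^sub>2 where "\<pi>\<^sub>2 = transpose (\<pi>\<^sub>1 3) c \<circ> \<pi>\<^sub>1"
  define \<pi>\<^sub>3 where "\<pi>\<^sub>3 = transpose (\<pi>\<^sub>2 4) d \<circ> \<pi>\<^sub>2"
  have 1: "\<pi>\<^sub>1 permutes {2..m}"
    unfolding \<pi>\<^sub>1_def by (rule permutes_swap_id) (use assms(1,2) in simp_all)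
  have "\<pi>\<^sub>1 3 \<in> {2..m}" using permutes_in_image[OF 1, of 3] assms(1) by simp
  then have 2: "\<pi>\<^sub>2 permutes {2..m}"
    unfolding \<pi>\<^sub>2_def by (intro permutes_compose[OF 1] permutes_swap_id assms(3))
  have "\<pi>\<^sub>2 4 \<in> {2..m}" using permutes_in_image[OF 2, of 4] assms(1) by simp
  then have 3: "\<pi>\<^sub>3 permutes {2..m}"
    unfolding \<pi>\<^sub>3_def by (intro permutes_compose[OF 2] permutes_swap_id assms(4))
  have v1: "\<pi>\<^sub>1 2 = b" by (simp add: \<pi>\<^sub>1_def)
  then have "\<pi>\<^sub>1 3 \<noteq> b" using injD[OF permutes_inj[OF 1], of 3 2] by auto
  then have v2: "\<pi>\<^sub>2 2 = b" "\<pi>\<^sub>2 3 = c" using v1 assms(5) by (simp_all add: \<pi>\<^sub>2_def)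
  then have "\<pi>\<^sub>2 4 \<noteq> b" "\<pi>\<^sub>2 4 \<noteq> c"
    using injD[OF permutes_inj[OF 2], of 4 2] injD[OF permutes_inj[OF 2], of 4 3] by auto
  then have v3: "\<pi>\<^sub>3 2 = b" "\<pi>\<^sub>3 3 = c" "\<pi>\<^sub>3 4 = d" using v2 assms(6,7) by (simp_all add: \<pi>\<^sub>3_def)
  moreover have "\<pi>\<^sub>3 1 = 1" using permutes_not_in[OF 3, of 1] by simp
  moreover have "\<pi>\<^sub>3 permutes {1..m}" by (rule permutes_subset[OF 3]) auto
  ultimately show ?thesis using that by blast
qed

lemma prod_split_two:
  fixes f :: "nat \<Rightarrow> 'a::comm_monoid_mult"
  assumes "2 \<le> n"
  shows "(\<Prod>s = 1..n. f s) = f 1 * f 2 * (\<Prod>s = 3..n. f s)"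
  using assms by (simp add: prod.atLeast_Suc_atMost numeral_2_eq_2 numeral_3_eq_3 mult.assoc)

text \<open>
  Compares the matchings that contain the edges \<open>{1, j}, {j + 1, j + 2}\<close> and
  \<open>{1, j + 2}, {j, j + 1}\<close> and otherwise agree.
\<close>

lemma sign_preserving_consecutive:
  assumes "\<sigma> \<in> sign_preserving n" "\<sigma> 1 = 1" "2 \<le> j" "j + 2 \<le> 2 * n"
  shows "\<sigma> j < \<sigma> (j + 1) \<longleftrightarrow> \<sigma> (j + 1) < \<sigma> (j + 2)"
proof -
  have n: "2 \<le> n" using assms(3,4) by simp
  have \<sigma>: "\<sigma> permutes {1..2 * n}"
    and pres: "\<And>\<pi>. \<pi> permutes {1..2 * n} \<Longrightarrow> matching_sign n (\<sigma> \<circ> \<pi>) = matching_sign n \<pi>"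
    using assms(1) by (auto simp: sign_preserving_def)
  obtain \<pi> where \<pi>: "\<pi> permutes {1..2 * n}"
    and val: "\<pi> 1 = 1" "\<pi> 2 = j" "\<pi> 3 = j + 1" "\<pi> 4 = j + 2"
    using permutation_with_prescribed_values[of "2 * n" j "j + 1" "j + 2"] assms(3,4) n by auto
  \<comment> \<open>Exchanging positions 2 and 4 pairs \<open>1\<close> with \<open>j + 2\<close>
    and \<open>j + 1\<close> with \<open>j\<close>.\<close>
  define \<pi>' where "\<pi>' = \<pi> \<circ> transpose 2 4"
  have sw: "transpose 2 4 permutes {1..2 * n}" using n by (intro permutes_swap_id) auto
  have \<pi>': "\<pi>' permutes {1..2 * n}" unfolding \<pi>'_def by (rule permutes_compose[OF sw \<pi>])
  have sign': "sign \<pi>' = - sign \<pi>"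
    unfolding \<pi>'_def using sign_compose_permutes[OF _ \<pi> sw] by (simp add: sign_swap_id)
  have val': "\<pi>' 1 = 1" "\<pi>' 2 = j + 2" "\<pi>' 3 = j + 1" "\<pi>' 4 = j"
    by (simp_all add: \<pi>'_def val transpose_def del: One_nat_def)
  define rest where "rest = (\<lambda>\<tau>. \<Prod>s = 3..n. sgn (int (\<tau> (2 * s)) - int (\<tau> (2 * s - 1))))"
  have ms: "matching_sign n \<tau> = sign \<tau> *
      (sgn (int (\<tau> 2) - int (\<tau> 1)) * sgn (int (\<tau> 4) - int (\<tau> 3)) * rest \<tau>)" for \<tau>
    unfolding matching_sign_def rest_def prod_split_two[OF n] by simp
  have rest': "rest (\<tau> \<circ> \<pi>') = rest (\<tau> \<circ> \<pi>)" for \<tau>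
    unfolding rest_def by (rule prod.cong) (auto simp: \<pi>'_def transpose_def)
  have nz: "rest \<tau> \<noteq> 0" if "\<tau> permutes {1..2 * n}" for \<tau>
  proof -
    have "matching_sign n \<tau> \<noteq> 0" using matching_sign_cases[OF that] by auto
    then show ?thesis by (simp add: ms)
  qed
  \<comment> \<open>Since \<open>\<sigma>\<close> fixes \<open>1\<close>, the block at
    \<open>1\<close> keeps the factor 1.\<close>
  have pos: "sgn (int (\<sigma> i) - 1) = 1" if "i \<in> {2..2 * n}" for i
  proof -
    have "\<sigma> i \<in> {1..2 * n}" using permutes_in_image[OF \<sigma>] that by auto
    moreover have "\<sigma> i \<noteq> 1" using injD[OF permutes_inj[OF \<sigma>], of i 1] assms(2) that by auto
    ultimately show ?thesis by simp
  qed
  have s1: "sgn (int (\<sigma> j) - 1) = 1" "sgn (int (\<sigma> (j + 2)) - 1) = 1"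
    using pos assms(3,4) by auto
  have eq: "sign (\<sigma> \<circ> \<pi>) * (sgn (int (\<sigma> (j + 2)) - int (\<sigma> (j + 1))) * rest (\<sigma> \<circ> \<pi>)) = sign \<pi> * rest \<pi>"
    using pres[OF \<pi>] s1 assms(2,3) by (simp add: ms val del: One_nat_def)
  \<comment> \<open>The minus sign on the right comes from the descending block
    \<open>j + 1, j\<close> of \<open>\<pi>'\<close>. It cancels the sign of the exchange, so this
    right side agrees with that of \<open>eq\<close>.\<close>
  have "sign (\<sigma> \<circ> \<pi>') * (sgn (int (\<sigma> j) - int (\<sigma> (j + 1))) * rest (\<sigma> \<circ> \<pi>)) =
      sign \<pi>' * (- rest \<pi>)"
    using pres[OF \<pi>'] s1 assms(2,3) rest'[of \<sigma>] rest'[of id] by (simp add: ms val' del: One_nat_def)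
  moreover have "sign (\<sigma> \<circ> \<pi>') = - sign (\<sigma> \<circ> \<pi>)"
    using sign_compose_permutes[OF _ \<sigma> \<pi>'] sign_compose_permutes[OF _ \<sigma> \<pi>] sign' by simp
  ultimately have "sign (\<sigma> \<circ> \<pi>) * (sgn (int (\<sigma> j) - int (\<sigma> (j + 1))) * rest (\<sigma> \<circ> \<pi>)) =
      sign (\<sigma> \<circ> \<pi>) * (- sgn (int (\<sigma> (j + 2)) - int (\<sigma> (j + 1))) * rest (\<sigma> \<circ> \<pi>))"
    using eq sign' by simp
  then have "sgn (int (\<sigma> j) - int (\<sigma> (j + 1))) = - sgn (int (\<sigma> (j + 2)) - int (\<sigma> (j + 1)))"
    by (simp only: mult_left_cancel[OF sign_nz] mult_right_cancel[OF nz[OF permutes_compose[OF \<pi> \<sigma>]]])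
  moreover have "\<sigma> j \<noteq> \<sigma> (j + 1)" "\<sigma> (j + 2) \<noteq> \<sigma> (j + 1)"
    using injD[OF permutes_inj[OF \<sigma>], of j "j + 1"]
      injD[OF permutes_inj[OF \<sigma>], of "j + 2" "j + 1"] by auto
  ultimately show ?thesis by (auto simp: sgn_if split: if_splits)
qed

text \<open>Strict growth gives \<open>i \<le> \<tau> i\<close> by induction, which forces a
  permutation of \<open>{1..m}\<close> to be the identity.\<close>

lemma permutes_increasing_imp_id:
  assumes "\<tau> permutes {1..m}" "\<And>j. 1 \<le> j \<Longrightarrow> j < m \<Longrightarrow> \<tau> j < \<tau> (Suc j)"
  shows "\<tau> = id"
proof (rule permutes_natset_ge[OF assms(1)], rule ballI)
  fix i assume "i \<in> {1..m}"
  then have "1 \<le> i" "i \<le> m" by auto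
  then show "i \<le> \<tau> i"
  proof (induction i rule: dec_induct)
    case base
    then show ?case using permutes_in_image[OF assms(1), of 1] by simp
  next
    case (step i)
    then show ?case using assms(2)[of i] by simp
  qed
qed

lemma sign_preserving_fixing_one:
  assumes "\<sigma> \<in> sign_preserving n" "\<sigma> 1 = 1"
  shows "\<sigma> = id \<or> \<sigma> = reflection (2 * n)"
proof -
  have \<sigma>: "\<sigma> permutes {1..2 * n}" using assms(1) by (simp add: sign_preserving_def)
  have in_range: "\<sigma> i \<in> {2..2 * n}" if "i \<in> {2..2 * n}" for i
  proof -
    have "\<sigma> i \<in> {1..2 * n}" using permutes_in_image[OF \<sigma>] that by auto
    moreover have "\<sigma> i \<noteq> 1" using injD[OF permutes_inj[OF \<sigma>], of i 1] assms(2) that by auto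
    ultimately show ?thesis by auto
  qed
  have same: "\<sigma> j < \<sigma> (Suc j) \<longleftrightarrow> \<sigma> 2 < \<sigma> 3" if "2 \<le> j" "j < 2 * n" for j
    using that
  proof (induction j rule: dec_induct)
    case (step j)
    then show ?case using sign_preserving_consecutive[OF assms, of j] by simp
  qed simp
  show ?thesis
  \<comment> \<open>For \<open>n = 1\<close> the point 3 lies outside the range and is fixed, as is
    2, so the first case occurs.\<close>
  proof (cases "\<sigma> 2 < \<sigma> 3")
    case True
    have "\<sigma> j < \<sigma> (Suc j)" if "1 \<le> j" "j < 2 * n" for j
    proof (cases "j = 1")
      case True
      then show ?thesis using in_range[of "Suc j"] that assms(2) by simp
    next
      case False
      then show ?thesis using same[of j] that \<open>\<sigma> 2 < \<sigma> 3\<close> by simp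
    qed
    then have "\<sigma> = id" by (rule permutes_increasing_imp_id[OF \<sigma>])
    then show ?thesis ..
  next
    case False
    let ?r = "reflection (2 * n)"
    \<comment> \<open>A decreasing \<open>\<sigma>\<close> becomes increasing after the reflection,
      also from \<open>1\<close> to \<open>2\<close>, since the reflection fixes \<open>1\<close>
      and preserves \<open>{2..2 * n}\<close>.\<close>
    have "(?r \<circ> \<sigma>) j < (?r \<circ> \<sigma>) (Suc j)" if "1 \<le> j" "j < 2 * n" for j
    proof (cases "j = 1")
      case True
      then have "\<sigma> j = 1" "2 \<le> \<sigma> (Suc j)" "\<sigma> (Suc j) \<le> 2 * n"
        using in_range[of "Suc j"] that assms(2) by simp_all
      then show ?thesis by (simp add: reflection_def)
    next
      case False
      then have "\<sigma> (Suc j) \<le> \<sigma> j" using that same[of j] \<open>\<not> \<sigma> 2 < \<sigma> 3\<close> by simp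
      moreover have "\<sigma> (Suc j) \<noteq> \<sigma> j"
        using injD[OF permutes_inj[OF \<sigma>], of "Suc j" j] by auto
      ultimately show ?thesis
        using in_range[of j] in_range[of "Suc j"] that False by (auto simp: reflection_def)
    qed
    then have r\<sigma>: "?r \<circ> \<sigma> = id"
      by (rule permutes_increasing_imp_id[OF permutes_compose[OF \<sigma> reflection_permutes]])
    have rr: "?r \<circ> ?r = id" by (auto simp: fun_eq_iff reflection_def)
    have "\<sigma> = (?r \<circ> ?r) \<circ> \<sigma>" by (simp only: rr id_comp)
    also have "\<dots> = ?r" by (simp only: comp_assoc r\<sigma> comp_id)
    finally have "\<sigma> = ?r" .
    then show ?thesis ..
  qed
qed

lemma dihedral_subgroup:
  assumes "1 \<le> m"
  shows "subgroup (dihedral m) (sym_group m)"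
  unfolding dihedral_def
  by (rule group.generate_is_subgroup[OF sym_group_is_group])
     (use assms cyc_shift_permutes reflection_permutes in \<open>auto simp: sym_group_carrier\<close>)

section \<open>Identification with the dihedral group\<close>

lemma sign_preserving_subset_dihedral:
  assumes "1 \<le> n"
  shows "sign_preserving n \<subseteq> dihedral (2 * n)"
proof
  let ?G = "sym_group (2 * n)" and ?c = "cyc_shift (2 * n)"
  have D: "subgroup (dihedral (2 * n)) ?G" using assms by (intro dihedral_subgroup) simp
  have gens: "?c \<in> dihedral (2 * n)" "reflection (2 * n) \<in> dihedral (2 * n)"
    by (auto simp: dihedral_def intro: generate.incl)
  have cancel: "\<sigma> \<in> dihedral (2 * n)"
    if "?c \<circ> \<sigma> \<in> dihedral (2 * n)" for \<sigma>
  proof -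
    have c: "?c permutes {1..2 * n}" by (rule cyc_shift_permutes) (use assms in simp)
    then have "inv_into UNIV ?c \<in> dihedral (2 * n)"
      using subgroup.m_inv_closed[OF D gens(1)] by (simp add: sym_group_carrier)
    from subgroup.m_closed[OF D this that] show ?thesis
      by (simp add: sym_group_mult permutes_inv_o(2)[OF c] flip: comp_assoc)
  qed
  fix \<sigma> assume "\<sigma> \<in> sign_preserving n"
  then show "\<sigma> \<in> dihedral (2 * n)"
  \<comment> \<open>The measure counts the shifts that carry \<open>\<sigma> 1\<close> to
    \<open>1\<close>. At \<open>\<sigma> 1 = 2 * n\<close> one shift reaches \<open>1\<close> and
    would raise the measure, so that case uses \<open>fixing\<close> instead of the induction
    hypothesis.\<close>
  proof (induction "2 * n + 1 - \<sigma> 1" arbitrary: \<sigma> rule: less_induct)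
    case less
    have \<sigma>: "\<sigma> permutes {1..2 * n}" using less.prems by (simp add: sign_preserving_def)
    have range: "\<sigma> 1 \<in> {1..2 * n}" using permutes_in_image[OF \<sigma>, of 1] assms by simp
    have fixing: "\<tau> \<in> dihedral (2 * n)" if "\<tau> \<in> sign_preserving n" "\<tau> 1 = 1" for \<tau>
      using sign_preserving_fixing_one[OF that] gens subgroup.one_closed[OF D]
      by (auto simp: sym_group_one)
    have c\<sigma>: "?c \<circ> \<sigma> \<in> sign_preserving n"
      using subgroup.m_closed[OF sign_preserving_subgroup cyc_shift_sign_preserving[OF assms] less.prems]
      by (simp add: sym_group_mult)
    show ?case
    proof (cases "\<sigma> 1 = 2 * n")
      case True
      then have "(?c \<circ> \<sigma>) 1 = 1" using assms by (simp add: cyc_shift_def)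
      with c\<sigma> show ?thesis by (blast intro: cancel fixing)
    next
      case False
      then have "(?c \<circ> \<sigma>) 1 = \<sigma> 1 + 1" using range by (auto simp: cyc_shift_def)
      then have "?c \<circ> \<sigma> \<in> dihedral (2 * n)"
        using range False by (intro less.hyps[OF _ c\<sigma>]) auto
      then show ?thesis by (rule cancel)
    qed
  qed
qed

lemma dihedral_subset_sign_preserving:
  assumes "1 \<le> n"
  shows "dihedral (2 * n) \<subseteq> sign_preserving n"
  unfolding dihedral_def
  by (rule group.generate_subgroup_incl[OF sym_group_is_group _ sign_preserving_subgroup])
     (use assms cyc_shift_sign_preserving reflection_sign_preserving in auto)

theorem theorem1p1:
  fixes n :: nat
  assumes "CHAR('k::field) \<noteq> 2" and "n \<ge> 1"
  shows "Sym n (pf n :: 'k pol) = dihedral (2 * n) \<and>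
    (sym_group (2 * n))\<lparr>carrier := Sym n (pf n :: 'k pol)\<rparr>
      \<cong> (sym_group (2 * n))\<lparr>carrier := dihedral (2 * n)\<rparr>"
proof -
  \<comment> \<open>Both groups coincide with \<open>sign_preserving n\<close>.\<close>
  have "Sym n (pf n :: 'k pol) = dihedral (2 * n)"
    using Sym_pf_subset[OF assms(1), of n] sign_preserving_subset[of n]
      sign_preserving_subset_dihedral[OF assms(2)] dihedral_subset_sign_preserving[OF assms(2)]
    by blast
  then show ?thesis by (simp add: iso_refl)
qed

end
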